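(* Let $X\subset\mathbb{R}^2$ be a reduced real algebraic curve, let $x\in X$ be an algebraic singular point, and let $\Gamma$ be a local branch of $X$ at $x$ which, in Euclidean coordinates with $x$ at the origin and the $x_1$-axis along the tangent line of $\Gamma$ at $x$, has a local parametrization $$x_1(t)=t^p,\qquad x_2(t)=c\,t^q+\sigma_{q+1}(t),$$ with $q>p\ge 2$, $c\neq 0$. If $p$ is odd and $k=[q/p]$ (integer part), then the branch $\Gamma$ is, locally at $x$, an embedded $C^k$ submanifold of $\mathbb{R}^2$.
   Context: A reduced real algebraic curve $X$ is given by $\Phi(x_1,x_2)=0$; an algebraic singular point is a point of $X$ where $\nabla\Phi=0$ (such points are isolated). At each singular point $X$ is a union of finitely many local branches, all assumed real and $1$-dimensional. The parametrization is a (Puiseux-type) real analytic injective parametrization of the branch defined for $t$ near $0$, and $\sigma_{q+1}(t)$ is a real convergent power series all of whose terms have degree $>q$. *)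

theory Defs
  imports
    "HOL-Analysis.Analysis"
    "HOL-Computational_Algebra.Computational_Algebra"
begin

section \<open>Plane real algebraic curves and their singular points\<close>

text \<open>
  A polynomial in two variables is an element of \<open>\<real>[x\<^sub>1][x\<^sub>2]\<close>: the outer
  variable is \<open>x\<^sub>2\<close>, the coefficients are polynomials in \<open>x\<^sub>1\<close>.
\<close>

definition eval2 :: "real poly poly \<Rightarrow> real^2 \<Rightarrow> real" where
  "eval2 \<Phi> y = poly (poly \<Phi> [:y$2:]) (y$1)"

definition zero_set :: "real poly poly \<Rightarrow> (real^2) set" where
  "zero_set \<Phi> = {y. eval2 \<Phi> y = 0}"

text \<open>
  The equation of a reduced curve has no multiple factors.  Squarefreeness in
  \<open>\<real>[x\<^sub>1][x\<^sub>2]\<close> covers all factors, including those in \<open>x\<^sub>1\<close> alone, and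
  excludes the zero polynomial.
\<close>

definition reduced_curve :: "real poly poly \<Rightarrow> (real^2) set \<Rightarrow> bool" where
  "reduced_curve \<Phi> X \<longleftrightarrow> squarefree \<Phi> \<and> X = zero_set \<Phi>"

definition algebraic_singular_point :: "real poly poly \<Rightarrow> real^2 \<Rightarrow> bool" where
  "algebraic_singular_point \<Phi> x \<longleftrightarrow> x \<in> zero_set \<Phi> \<and> GDERIV (eval2 \<Phi>) x :> 0"


section \<open>Local branches\<close>

definition same_germ :: "'a::topological_space \<Rightarrow> 'a set \<Rightarrow> 'a set \<Rightarrow> bool" where
  "same_germ x A B \<longleftrightarrow> (\<forall>\<^sub>F y in nhds x. y \<in> A \<longleftrightarrow> y \<in> B)"

definition real_analytic_at :: "(real \<Rightarrow> real) \<Rightarrow> real \<Rightarrow> bool" where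
  "real_analytic_at f t \<longleftrightarrow> (\<exists>F. (\<lambda>h. f (t + h)) has_fps_expansion F)"

text \<open>
  A branch is considered as a set germ at \<open>x\<close>.  Injectivity is required on the
  closed interval, which makes the parametrization a topological embedding;
  hence the arc cannot return to \<open>x\<close> and its germ at \<open>x\<close> does not depend on
  the length of the interval.
\<close>

definition local_branch :: "(real^2) set \<Rightarrow> real^2 \<Rightarrow> (real^2) set \<Rightarrow> bool" where
  "local_branch X x \<Gamma> \<longleftrightarrow>
     (\<exists>\<epsilon> \<gamma>. 0 < \<epsilon> \<and>
        (\<forall>t\<in>{-\<epsilon>..\<epsilon>}. \<forall>i. real_analytic_at (\<lambda>s. \<gamma> s $ i) t) \<and>
        inj_on \<gamma> {-\<epsilon>..\<epsilon>} \<and> \<gamma> 0 = x \<and> \<gamma> ` {-\<epsilon>..\<epsilon>} \<subseteq> X \<and>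
        same_germ x \<Gamma> (\<gamma> ` {-\<epsilon><..<\<epsilon>}))"

text \<open>
  Near each singular point the curve is a finite union of real one-dimensional
  branches; this excludes isolated real points.
\<close>

definition union_of_real_branches :: "real poly poly \<Rightarrow> bool" where
  "union_of_real_branches \<Phi> \<longleftrightarrow>
     (\<forall>x. algebraic_singular_point \<Phi> x \<longrightarrow>
        (\<exists>\<B>. finite \<B> \<and> (\<forall>B\<in>\<B>. local_branch (zero_set \<Phi>) x B) \<and>
              same_germ x (zero_set \<Phi>) (\<Union>\<B>)))"

definition tangent_line :: "(real^2) set \<Rightarrow> real^2 \<Rightarrow> (real^2) set \<Rightarrow> bool" where
  "tangent_line \<Gamma> x L \<longleftrightarrow>
     (\<exists>v. v \<noteq> 0 \<and> L = {x + s *\<^sub>R v | s. True}) \<and>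
     ((\<lambda>y. infdist y L / dist y x) \<longlongrightarrow> 0) (at x within \<Gamma>)"

text \<open>
  In the coordinates \<open>y \<mapsto> T (y - x)\<close>, with \<open>T\<close> orthogonal, the branch \<open>\<Gamma>\<close> is
  injectively parametrized by \<open>(t^p, c t^q + \<sigma>(t))\<close> for \<open>t\<close> near \<open>0\<close>, where \<open>\<sigma>\<close>
  is a convergent power series all of whose terms have degree greater than \<open>q\<close>.
\<close>

definition branch_parametrization ::
  "(real^2) set \<Rightarrow> real^2 \<Rightarrow> (real^2 \<Rightarrow> real^2) \<Rightarrow> nat \<Rightarrow> nat \<Rightarrow> real \<Rightarrow> real fps \<Rightarrow> bool"
where
  "branch_parametrization \<Gamma> x T p q c \<sigma> \<longleftrightarrow>
     (\<forall>n\<le>q. fps_nth \<sigma> n = 0) \<and>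
     (\<exists>\<epsilon>>0. ereal \<epsilon> \<le> fps_conv_radius \<sigma> \<and>
        (let \<gamma> = (\<lambda>t. vector [t ^ p, c * t ^ q + eval_fps \<sigma> t]) :: real \<Rightarrow> real^2 in
           inj_on \<gamma> {-\<epsilon><..<\<epsilon>} \<and>
           same_germ 0 ((\<lambda>y. T (y - x)) ` \<Gamma>) (\<gamma> ` {-\<epsilon><..<\<epsilon>})))"


section \<open>Embedded submanifolds of class \<open>C\<^sup>k\<close>\<close>

text \<open>
  For open \<open>S\<close> in a Euclidean space, the differential is of class \<open>C\<^sup>k\<close> iff its
  values in all fixed directions are.
\<close>

primrec Ck_on ::
  "nat \<Rightarrow> ('a::euclidean_space \<Rightarrow> 'b::euclidean_space) \<Rightarrow> 'a set \<Rightarrow> bool"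
where
  "Ck_on 0 f S \<longleftrightarrow> continuous_on S f"
| "Ck_on (Suc k) f S \<longleftrightarrow>
     (\<forall>x\<in>S. f differentiable (at x)) \<and>
     (\<forall>v. Ck_on k (\<lambda>x. frechet_derivative f (at x) v) S)"

text \<open>
  Locally \<open>M\<close> is flattened onto a linear subspace of dimension \<open>d\<close> by a \<open>C\<^sup>k\<close>
  diffeomorphism \<open>\<phi>\<close> between open sets, with inverse \<open>\<psi>\<close>.
\<close>

definition embedded_Ck_submanifold :: "nat \<Rightarrow> nat \<Rightarrow> 'a::euclidean_space set \<Rightarrow> bool" where
  "embedded_Ck_submanifold k d M \<longleftrightarrow>
     (\<forall>y\<in>M. \<exists>(U :: 'a set) (V :: 'a set) \<phi> \<psi> L.
        open U \<and> y \<in> U \<and> open V \<and> homeomorphism U V \<phi> \<psi> \<and>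
        Ck_on k \<phi> U \<and> Ck_on k \<psi> V \<and>
        subspace L \<and> dim L = d \<and> \<phi> ` (M \<inter> U) = L \<inter> V)"

definition locally_embedded_Ck_submanifold ::
  "nat \<Rightarrow> nat \<Rightarrow> 'a::euclidean_space set \<Rightarrow> 'a \<Rightarrow> bool"
where
  "locally_embedded_Ck_submanifold k d M x \<longleftrightarrow>
     x \<in> M \<and> (\<exists>W. open W \<and> x \<in> W \<and> embedded_Ck_submanifold k d (M \<inter> W))"

end

theory Submission
  imports Defs
begin

text \<open>
  For odd \<open>p\<close> the substitution \<open>t = u\<^bsup>1/p\<^esup>\<close> is defined for all real \<open>u\<close> and turns the branch
  into the graph of \<open>g u = h (u\<^bsup>1/p\<^esup>)\<close>, where \<open>h\<close> is a convergent power series of order \<open>q\<close>.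
  Differentiating in \<open>u\<close> replaces \<open>h\<close> by \<open>h' / (p t\<^bsup>p-1\<^esup>)\<close>, which lowers the order of the series
  by \<open>p\<close> and is again a power series while the order is at least \<open>p\<close>; so \<open>g\<close> has \<open>[q/p]\<close>
  continuous derivatives. The shear \<open>(z\<^sub>1, z\<^sub>2) \<mapsto> (z\<^sub>1, z\<^sub>2 - g z\<^sub>1)\<close> flattens the graph.
\<close>

section \<open>Calculus of \<open>Ck_on\<close>\<close>

lemma Ck_on_cong:
  assumes "open S" "Ck_on k f S" "\<And>x. x \<in> S \<Longrightarrow> f x = g x"
  shows "Ck_on k g S"
  using assms(2,3)
proof (induction k arbitrary: f g)
  case 0
  then show ?case by (simp cong: continuous_on_cong)
next
  case (Suc k)
  \<comment> \<open>Openness turns agreement on \<open>S\<close> into agreement near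
    \<open>x\<close>, so \<open>f\<close> and \<open>g\<close> share their derivative there and the
    induction hypothesis applies in each direction.\<close>
  have D: "(g has_derivative frechet_derivative f (at x)) (at x)" if "x \<in> S" for x
  proof (rule has_derivative_transform_within_open)
    show "(f has_derivative frechet_derivative f (at x)) (at x)"
      using Suc.prems(1) that by (simp flip: frechet_derivative_works)
  qed (use \<open>open S\<close> that Suc.prems(2) in auto)
  have "Ck_on k (\<lambda>x. frechet_derivative g (at x) v) S" for v
  proof (rule Suc.IH)
    show "Ck_on k (\<lambda>x. frechet_derivative f (at x) v) S"
      using Suc.prems(1) by simp
    show "frechet_derivative f (at x) v = frechet_derivative g (at x) v" if "x \<in> S" for x
      using frechet_derivative_at[OF D[OF that]] by simp
  qed
  then show ?case
    using D by (auto simp: differentiable_def)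
qed

lemma Ck_on_subset: "Ck_on k f S \<Longrightarrow> S' \<subseteq> S \<Longrightarrow> Ck_on k f S'"
  by (induction k arbitrary: f) (auto intro: continuous_on_subset)

text \<open>Lets an explicit formula stand in for \<open>frechet_derivative\<close>, so that the
  inductions below run on concrete derivatives.\<close>

lemma Ck_on_SucI:
  assumes "open S" and D: "\<And>x. x \<in> S \<Longrightarrow> (f has_derivative f' x) (at x)"
    and Ck: "\<And>v. Ck_on k (\<lambda>x. f' x v) S"
  shows "Ck_on (Suc k) f S"
proof -
  have "Ck_on k (\<lambda>x. frechet_derivative f (at x) v) S" for v
    using \<open>open S\<close> Ck[of v] by (rule Ck_on_cong) (use frechet_derivative_at[OF D] in simp)
  then show ?thesis
    using D by (auto simp: differentiable_def)
qed

lemma Ck_on_add: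
  assumes "open S" "Ck_on k f S" "Ck_on k g S"
  shows "Ck_on k (\<lambda>x. f x + g x) S"
  using assms(2,3)
proof (induction k arbitrary: f g)
  case 0
  then show ?case by (simp add: continuous_on_add)
next
  case (Suc k)
  show ?case
  proof (rule Ck_on_SucI[OF \<open>open S\<close>])
    show "((\<lambda>x. f x + g x) has_derivative
        (\<lambda>v. frechet_derivative f (at x) v + frechet_derivative g (at x) v)) (at x)"
      if "x \<in> S" for x
      using Suc.prems that by (auto intro: has_derivative_add simp flip: frechet_derivative_works)
  qed (use Suc in simp)
qed

lemma Ck_on_affine:
  assumes "open S" "bounded_linear A"
  shows "Ck_on k (\<lambda>x. A x + a) S"
  using assms(2)
proof (induction k arbitrary: A a)
  case 0
  then show ?case
    by (simp add: linear_continuous_on continuous_on_add)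
next
  case (Suc k)
  show ?case
  proof (rule Ck_on_SucI[OF \<open>open S\<close>])
    show "((\<lambda>x. A x + a) has_derivative A) (at x)" for x
      using has_derivative_add[OF bounded_linear_imp_has_derivative[OF Suc.prems] has_derivative_const]
      by simp
    \<comment> \<open>A directional derivative is constant, hence affine with zero linear part; this
      is why the induction varies \<open>A\<close> and \<open>a\<close>.\<close>
    show "Ck_on k (\<lambda>x. A v) S" for v
      using Suc.IH[OF bounded_linear_zero, of "A v"] by simp
  qed
qed

section \<open>Power series in an odd root\<close>

lemma eval_fps_shift_eq:
  fixes F :: "real fps"
  assumes "\<And>n. n < m \<Longrightarrow> fps_nth F n = 0" "ereal \<bar>t\<bar> < fps_conv_radius F"
  shows "eval_fps F t = t ^ m * eval_fps (fps_shift m F) t"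
proof -
  have "F = fps_X ^ m * fps_shift m F"
    using assms(1) by (intro fps_ext) (simp add: fps_X_power_mult_nth)
  then have "eval_fps F t = eval_fps (fps_X ^ m * fps_shift m F) t" by simp
  also have "\<dots> = t ^ m * eval_fps (fps_shift m F) t"
    using assms(2) by (subst eval_fps_mult) auto
  finally show ?thesis .
qed

lemma ereal_less_radius: "t < r \<Longrightarrow> ereal r \<le> R \<Longrightarrow> ereal t < R"
  by (rule less_le_trans[of _ "ereal r"]) simp_all

text \<open>With \<open>t = root p u\<close>, the chain rule gives F'(t) / (p t^(p-1)) for u away
  from 0. Since F has order at least \<open>p\<close>, F' is divisible by t^(p-1), so this quotient
  is again a power series in t and extends to t = 0.\<close>

lemma has_real_derivative_eval_fps_root:
  fixes F :: "real fps"
  assumes "odd p" and zero: "\<And>n. n < p \<Longrightarrow> fps_nth F n = 0"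
    and rad: "ereal \<bar>root p u\<bar> < fps_conv_radius F"
  shows "((\<lambda>u. eval_fps F (root p u)) has_real_derivative
           eval_fps (fps_const (1 / p) * fps_shift (p - 1) (fps_deriv F)) (root p u)) (at u)"
proof -
  let ?F1 = "fps_const (1 / real p) * fps_shift (p - 1) (fps_deriv F)"
  have p: "p > 0" using \<open>odd p\<close> by (rule odd_pos)
  have rad': "ereal \<bar>root p u\<bar> < fps_conv_radius (fps_deriv F)"
    using rad fps_conv_radius_deriv[of F] by (rule less_le_trans)
  show ?thesis
  proof (cases "u = 0")
    case False
    let ?t = "root p u"
    have t0: "?t \<noteq> 0" using False p by simp
    have "eval_fps (fps_deriv F) ?t = ?t ^ (p - 1) * eval_fps (fps_shift (p - 1) (fps_deriv F)) ?t"
      using zero rad' by (intro eval_fps_shift_eq) auto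
    moreover have "eval_fps ?F1 ?t = eval_fps (fps_shift (p - 1) (fps_deriv F)) ?t / p"
      using rad' by (subst eval_fps_mult) auto
    ultimately have eq: "eval_fps ?F1 ?t
        = eval_fps (fps_deriv F) ?t * inverse (p * ?t ^ (p - Suc 0))"
      using t0 p by (simp add: field_simps)
    have "(eval_fps F has_real_derivative eval_fps (fps_deriv F) ?t) (at ?t)"
      using rad by (intro has_field_derivative_eval_fps) auto
    from DERIV_chain2[OF this DERIV_odd_real_root[OF \<open>odd p\<close> False]] show ?thesis
      unfolding eq .
  next
    \<comment> \<open>For \<open>p > 1\<close> the root is not differentiable at 0, so the
      difference quotient is computed directly: as (root p h)^p = h, it equals
      \<open>fps_shift p F\<close> at \<open>root p h\<close>, which tends to the coefficient of
      index \<open>p\<close>.\<close>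
    case True
    have pos: "fps_conv_radius F > 0" using rad True by (simp flip: zero_ereal_def)
    obtain r where r: "r > 0" "ereal r < fps_conv_radius F"
      using ereal_dense2[OF pos] by (metis ereal_less(2))
    have cont: "isCont (\<lambda>h. eval_fps (fps_shift p F) (root p h)) 0"
    proof (rule isCont_o2[where g = "eval_fps (fps_shift p F)"])
      show "isCont (root p) 0" by (rule isCont_real_root)
      have "continuous (at (0::real)) (eval_fps (fps_shift p F))"
        by (intro continuous_eval_fps) (use pos in \<open>simp_all flip: zero_ereal_def\<close>)
      then show "isCont (eval_fps (fps_shift p F)) (root p 0)" by simp
    qed
    have ev: "\<forall>\<^sub>F h in at 0. \<bar>root p h\<bar> < r"
    proof -
      have "((\<lambda>h. \<bar>root p h\<bar>) \<longlongrightarrow> \<bar>root p 0\<bar>) (at 0)"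
        by (intro tendsto_intros)
      then show ?thesis using r(1) by (intro order_tendstoD) auto
    qed
    have "((\<lambda>h. eval_fps (fps_shift p F) (root p h)) \<longlongrightarrow> fps_nth F p) (at 0)"
      using cont by (simp add: isCont_def eval_fps_at_0)
    moreover have "\<forall>\<^sub>F h in at 0. eval_fps (fps_shift p F) (root p h)
        = (eval_fps F (root p (0 + h)) - eval_fps F (root p 0)) / h"
      using ev eventually_neq_at_within[of 0 0 UNIV]
    proof (eventually_elim)
      case (elim h)
      have "ereal \<bar>root p h\<bar> < fps_conv_radius F"
        using elim(1) r(2) by (meson ereal_less_eq(3) le_less_trans less_imp_le)
      then have "eval_fps F (root p h) = root p h ^ p * eval_fps (fps_shift p F) (root p h)"
        using zero by (intro eval_fps_shift_eq)
      then show ?case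
        using elim(2) zero[OF p] \<open>odd p\<close> by (simp add: eval_fps_at_0 odd_real_root_pow)
    qed
    ultimately have "((\<lambda>h. (eval_fps F (root p (0 + h)) - eval_fps F (root p 0)) / h)
        \<longlongrightarrow> fps_nth F p) (at 0)"
      by (rule Lim_transform_eventually)
    \<comment> \<open>The factor \<open>p\<close> from differentiating the term of degree
      \<open>p\<close> cancels \<open>1 / p\<close>.\<close>
    moreover have "eval_fps ?F1 (root p u) = fps_nth F p"
      using True p by (simp add: eval_fps_at_0)
    ultimately show ?thesis
      using True by (simp add: DERIV_def)
  qed
qed

text \<open>Induction on \<open>k\<close>: each derivative lowers the order of the series by
  \<open>p\<close> without shrinking its radius, so the domain stays fixed. The direction enters
  only through the scalar \<open>A v\<close>, which is absorbed into \<open>b\<close>. Arbitrary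
  \<open>A\<close>, \<open>a\<close> and \<open>b\<close> let the lemma serve both the chart and its
  inverse.\<close>

lemma Ck_on_eval_fps_root:
  fixes F :: "real fps" and A :: "'a::euclidean_space \<Rightarrow> real" and b :: "'b::euclidean_space"
  assumes "odd p" "bounded_linear A"
    and "\<And>n. n < k * p \<Longrightarrow> fps_nth F n = 0" "ereal r \<le> fps_conv_radius F"
  shows "Ck_on k (\<lambda>y. eval_fps F (root p (A y + a)) *\<^sub>R b) {y. \<bar>root p (A y + a)\<bar> < r}"
  using assms(3,4)
proof (induction k arbitrary: F b)
  let ?S = "{y. \<bar>root p (A y + a)\<bar> < r}"
  case 0
  have "continuous_on ?S (\<lambda>y. eval_fps F (root p (A y + a)))"
  proof (rule continuous_on_compose2[OF continuous_on_eval_fps])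
    show "continuous_on ?S (\<lambda>y. root p (A y + a))"
      by (intro continuous_intros linear_continuous_on assms)
    show "(\<lambda>y. root p (A y + a)) ` ?S \<subseteq> eball 0 (fps_conv_radius F)"
      using 0 by (auto intro: ereal_less_radius)
  qed
  then show ?case by (simp add: continuous_intros)
next
  let ?S = "{y. \<bar>root p (A y + a)\<bar> < r}"
  case (Suc k)
  let ?F1 = "fps_const (1 / real p) * fps_shift (p - 1) (fps_deriv F)"
  have p: "p > 0" using \<open>odd p\<close> by (rule odd_pos)
  have "open ?S"
    by (intro open_Collect_less continuous_intros linear_continuous_on assms)
  then show ?case
  proof (rule Ck_on_SucI)
    fix y assume "y \<in> ?S"
    then have "ereal \<bar>root p (A y + a)\<bar> < fps_conv_radius F"
      using Suc.prems(2) by (auto intro: ereal_less_radius)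
    then have "((\<lambda>u. eval_fps F (root p u)) has_real_derivative
           eval_fps ?F1 (root p (A y + a))) (at (A y + a))"
      using Suc.prems(1) by (intro has_real_derivative_eval_fps_root assms) auto
    moreover have "((\<lambda>y. A y + a) has_derivative A) (at y)"
      using has_derivative_add[OF bounded_linear_imp_has_derivative[OF assms(2)] has_derivative_const]
      by simp
    ultimately have "((\<lambda>y. eval_fps F (root p (A y + a))) has_derivative
        (\<lambda>v. A v * eval_fps ?F1 (root p (A y + a)))) (at y)"
      by (rule DERIV_compose_FDERIV)
    then show "((\<lambda>y. eval_fps F (root p (A y + a)) *\<^sub>R b) has_derivative
        (\<lambda>v. (A v * eval_fps ?F1 (root p (A y + a))) *\<^sub>R b)) (at y)"
      by (rule has_derivative_scaleR_left)
  next
    fix v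
    have "Ck_on k (\<lambda>y. eval_fps ?F1 (root p (A y + a)) *\<^sub>R (A v *\<^sub>R b)) ?S"
    proof (rule Suc.IH)
      \<comment> \<open>The coefficient of \<open>?F1\<close> at \<open>n\<close> is a multiple of
        that of \<open>F\<close> at \<open>n + p\<close>, and n + p < (k + 1) p.\<close>
      show "fps_nth ?F1 n = 0" if "n < k * p" for n
        using that p Suc.prems(1)[of "n + p"] by simp
      have "fps_conv_radius F \<le> fps_conv_radius (fps_shift (p - 1) (fps_deriv F))"
        using fps_conv_radius_deriv[of F] by simp
      also have "\<dots> \<le> fps_conv_radius ?F1"
        using fps_conv_radius_mult[of "fps_const (1 / real p)" "fps_shift (p - 1) (fps_deriv F)"]
        by simp
      finally show "ereal r \<le> fps_conv_radius ?F1"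
        using Suc.prems(2) by simp
    qed
    then show "Ck_on k (\<lambda>y. (A v * eval_fps ?F1 (root p (A y + a))) *\<^sub>R b) ?S"
      by (simp add: mult.commute)
  qed
qed

theorem proposition1:
  fixes \<Phi> :: "real poly poly"
    and X \<Gamma> L :: "(real^2) set"
    and x :: "real^2"
    and T :: "real^2 \<Rightarrow> real^2"
    and p q k :: nat
    and c :: real
    and \<sigma> :: "real fps"
  assumes "reduced_curve \<Phi> X"
    and "union_of_real_branches \<Phi>"
    and "algebraic_singular_point \<Phi> x"
    and "local_branch X x \<Gamma>"
    and "orthogonal_transformation T"
    and "tangent_line \<Gamma> x L"
    and "(\<lambda>y. T (y - x)) ` L = {z. z$2 = 0}"
    and "branch_parametrization \<Gamma> x T p q c \<sigma>"
    and "2 \<le> p" and "p < q" and "c \<noteq> 0"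
    and "odd p" and "k = q div p"
  shows "locally_embedded_Ck_submanifold k 1 \<Gamma> x"
proof -

  \<comment> \<open>The branch as a graph\<close>
  from \<open>branch_parametrization \<Gamma> x T p q c \<sigma>\<close> obtain \<epsilon> where
    \<sigma>: "\<And>n. n \<le> q \<Longrightarrow> fps_nth \<sigma> n = 0" and \<epsilon>: "\<epsilon> > 0" "ereal \<epsilon> \<le> fps_conv_radius \<sigma>" and
    germ: "same_germ 0 ((\<lambda>y. T (y - x)) ` \<Gamma>)
      ((\<lambda>t. vector [t ^ p, c * t ^ q + eval_fps \<sigma> t] :: real^2) ` {-\<epsilon><..<\<epsilon>})"
    unfolding branch_parametrization_def Let_def by blast
  define F where "F = fps_const c * fps_X ^ q + \<sigma>"
  define g where "g u = eval_fps F (root p u)" for u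
  define e2 :: "real^2" where "e2 = axis 2 1"
  have e2 [simp]: "e2 $ 1 = 0" "e2 $ 2 = 1" by (simp_all add: e2_def axis_def)
  have cX: "fps_conv_radius (fps_const c * fps_X ^ q) = \<infinity>"
    using fps_conv_radius_mult[of "fps_const c" "fps_X ^ q"] by simp
  have radF: "ereal \<epsilon> \<le> fps_conv_radius F"
    using fps_conv_radius_add[of "fps_const c * fps_X ^ q" \<sigma>] \<epsilon>(2) cX by (simp add: F_def)
  have F_eval: "eval_fps F t = c * t ^ q + eval_fps \<sigma> t" if "\<bar>t\<bar> < \<epsilon>" for t
  proof -
    have "ereal \<bar>t\<bar> < fps_conv_radius \<sigma>"
      using that \<epsilon>(2) by (rule ereal_less_radius)
    then show ?thesis
      unfolding F_def using cX by (simp add: eval_fps_add eval_fps_mult)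
  qed
  \<comment> \<open>The integer part enters here: k p \<le> q, and \<open>F\<close> has no term
    below degree \<open>q\<close>.\<close>
  have F0: "fps_nth F n = 0" if "n < k * p" for n
  proof -
    have "n < q" using that \<open>k = q div p\<close> by (meson div_times_less_eq_dividend less_le_trans)
    then show ?thesis using \<sigma> by (simp add: F_def)
  qed
  \<comment> \<open>Oddness makes t = \<open>root p (z$1)\<close> the only possible parameter for
    \<open>z\<close>, whatever the sign of \<open>z$1\<close>, so the arc is a full two-sided
    graph.\<close>
  have graph: "z \<in> (\<lambda>t. vector [t ^ p, c * t ^ q + eval_fps \<sigma> t]) ` {-\<epsilon><..<\<epsilon>}
      \<longleftrightarrow> \<bar>root p (z$1)\<bar> < \<epsilon> \<and> z$2 = g (z$1)" (is "?l \<longleftrightarrow> ?r") for z :: "real^2"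
  proof
    assume ?l
    then obtain t where "t \<in> {-\<epsilon><..<\<epsilon>}" and z: "z = vector [t ^ p, c * t ^ q + eval_fps \<sigma> t]"
      by (rule imageE)
    then have "\<bar>t\<bar> < \<epsilon>" by auto
    moreover have "root p (t ^ p) = t" using \<open>odd p\<close> by (rule odd_real_root_power_cancel)
    ultimately show ?r by (simp add: z g_def F_eval)
  next
    assume r: ?r
    let ?t = "root p (z$1)"
    have "z = vector [?t ^ p, c * ?t ^ q + eval_fps \<sigma> ?t]"
      using r \<open>odd p\<close> by (simp add: vec_eq_iff forall_2 odd_real_root_pow g_def F_eval)
    then show ?l using r by (intro image_eqI[of _ _ ?t]) auto
  qed

  \<comment> \<open>The straightening chart\<close>
  define Ti where "Ti = inv T"
  have bij: "bij T" using assms(5) by (rule orthogonal_transformation_bij)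
  have linT: "linear T" using assms(5) by (rule orthogonal_transformation_linear)
  have linTi: "linear Ti"
    unfolding Ti_def using assms(5) by (intro orthogonal_transformation_linear orthogonal_transformation_inv)
  have TTi [simp]: "T (Ti z) = z" "Ti (T z) = z" for z
    using bij by (simp_all add: Ti_def bij_is_surj surj_f_inv_f bij_is_inj)
  note blT = linT[unfolded linear_conv_bounded_linear]
  note blTi = linTi[unfolded linear_conv_bounded_linear]
  have Tdiff: "T (y - x) = T y - T x" for y using linT by (rule linear_diff)

  obtain N where N: "open N" "0 \<in> N" and
    N_iff: "\<And>z. z \<in> N \<Longrightarrow> z \<in> (\<lambda>y. T (y - x)) ` \<Gamma> \<longleftrightarrow> \<bar>root p (z$1)\<bar> < \<epsilon> \<and> z$2 = g (z$1)"
    using germ unfolding same_germ_def eventually_nhds graph by auto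
  \<comment> \<open>On the strip \<open>D\<close> the series converges at the root, so
    \<open>g\<close> is regular there; on \<open>N\<close> the moved branch is the graph.
    \<open>U\<close> needs both, whereas \<open>V\<close> is cut out by \<open>\<psi>\<close> so as
    to be exactly the image of \<open>U\<close>.\<close>
  define D where "D = {z :: real^2. \<bar>root p (z$1)\<bar> < \<epsilon>}"
  define D' where "D' = {y. T (y - x) \<in> D}"
  define \<phi> where "\<phi> y = T (y - x) + (- g (T (y - x) $ 1)) *\<^sub>R e2" for y
  define \<psi> where "\<psi> z = x + Ti (z + g (z $ 1) *\<^sub>R e2)" for z
  define U where "U = {y. T (y - x) \<in> D \<inter> N}"
  define V where "V = {z \<in> D. \<psi> z \<in> U}"

  have openD: "open D"
    unfolding D_def by (intro open_Collect_less continuous_intros)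
  have contT: "continuous_on S (\<lambda>y. T (y - x))" for S
    by (intro linear_continuous_on_compose[OF _ linT] continuous_intros)
  have openD': "open D'" and openU: "open U"
    using open_vimage[OF openD contT] open_vimage[OF open_Int[OF openD N(1)] contT]
    by (simp_all add: D'_def U_def vimage_def)
  have UD': "U \<subseteq> D'" by (auto simp: U_def D'_def)

  \<comment> \<open>\<open>\<phi>\<close> written as an affine map plus a series in a root times a
    fixed vector; \<open>\<psi>\<close> is treated likewise below.\<close>
  have "Ck_on k (\<lambda>y. (T y + (- T x)) + eval_fps F (root p (T y $ 1 + (- T x $ 1))) *\<^sub>R (- e2))
          {y. \<bar>root p (T y $ 1 + (- T x $ 1))\<bar> < \<epsilon>}" (is "Ck_on _ _ ?D'")
  proof (rule Ck_on_add)
    show "open ?D'" using openD' by (simp add: D'_def D_def Tdiff)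
    then show "Ck_on k (\<lambda>y. T y + (- T x)) ?D'"
      using blT by (rule Ck_on_affine)
    show "Ck_on k (\<lambda>y. eval_fps F (root p (T y $ 1 + (- T x $ 1))) *\<^sub>R (- e2)) ?D'"
      by (intro Ck_on_eval_fps_root \<open>odd p\<close> F0 radF bounded_linear_compose[OF bounded_linear_vec_nth blT])
  qed
  then have Ck\<phi>: "Ck_on k \<phi> D'"
    by (simp add: \<phi>_def[abs_def] g_def D'_def D_def Tdiff)

  have "Ck_on k (\<lambda>z. (Ti z + x) + eval_fps F (root p (z $ 1 + 0)) *\<^sub>R Ti e2)
          {z. \<bar>root p (z $ 1 + 0)\<bar> < \<epsilon>}" (is "Ck_on _ _ ?D")
  proof (rule Ck_on_add)
    show "open ?D" using openD by (simp add: D_def)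
    then show "Ck_on k (\<lambda>z. Ti z + x) ?D"
      using blTi by (rule Ck_on_affine)
    show "Ck_on k (\<lambda>z. eval_fps F (root p (z $ 1 + 0)) *\<^sub>R Ti e2) ?D"
      by (intro Ck_on_eval_fps_root \<open>odd p\<close> F0 radF bounded_linear_vec_nth)
  qed
  then have Ck\<psi>: "Ck_on k \<psi> D"
    by (simp add: \<psi>_def[abs_def] g_def D_def linear_add[OF linTi] linear_scale[OF linTi] algebra_simps)

  have Ck_cont: "continuous_on S f" if "Ck_on j f S" for j S and f :: "real^2 \<Rightarrow> real^2"
    using that by (cases j) (auto intro!: continuous_at_imp_continuous_on differentiable_imp_continuous_within)
  have T\<psi>: "T (\<psi> z - x) = z + g (z $ 1) *\<^sub>R e2" for z by (simp add: \<psi>_def)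
  \<comment> \<open>A shear keeps the first coordinate, so the term subtracted by
    \<open>\<phi>\<close> is the one added by \<open>\<psi>\<close>. The identities hold on the
    whole plane, whatever value \<open>g\<close> takes outside the strip.\<close>
  have \<phi>\<psi>: "\<phi> (\<psi> z) = z" for z by (simp add: \<phi>_def T\<psi>)
  have \<phi>1: "\<phi> y $ 1 = T (y - x) $ 1" for y by (simp add: \<phi>_def)
  have \<psi>\<phi>: "\<psi> (\<phi> y) = y" for y
  proof -
    have "\<phi> y + g (\<phi> y $ 1) *\<^sub>R e2 = T (y - x)" unfolding \<phi>1 by (simp add: \<phi>_def)
    then show ?thesis by (simp add: \<psi>_def)
  qed
  have openV: "open V"
    using continuous_open_preimage[OF Ck_cont[OF Ck\<psi>] openD openU]
    by (simp add: V_def vimage_def Int_def)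
  have VD: "V \<subseteq> D" by (auto simp: V_def)
  have \<phi>U: "\<phi> y \<in> V" if "y \<in> U" for y
    using that \<phi>1[of y] by (simp add: V_def \<psi>\<phi> U_def D_def)
  have homeo: "homeomorphism U V \<phi> \<psi>"
  proof (rule homeomorphismI)
    show "continuous_on U \<phi>" "continuous_on V \<psi>"
      using Ck_cont[OF Ck\<phi>] Ck_cont[OF Ck\<psi>] UD' VD continuous_on_subset by blast+
  qed (use \<phi>U \<phi>\<psi> \<psi>\<phi> in \<open>auto simp: V_def\<close>)

  \<comment> \<open>Flattening the branch\<close>
  let ?L = "{z :: real^2. z $ 2 = 0}"
  have subL: "subspace ?L" by (simp add: subspace_def)
  have "dim {z. e2 \<bullet> z = 0} = 1"
    using dim_hyperplane[of e2] e2(2) by fastforce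
  then have dimL: "dim ?L = 1" by (simp add: e2_def inner_axis')
  \<comment> \<open>The second coordinate of \<open>\<phi> y\<close> is the vertical distance, with
    sign, from the moved point to the graph.\<close>
  have \<Gamma>_iff: "y \<in> \<Gamma> \<longleftrightarrow> \<phi> y \<in> ?L" if "y \<in> U" for y
  proof -
    have "y \<in> \<Gamma> \<longleftrightarrow> T (y - x) \<in> (\<lambda>y. T (y - x)) ` \<Gamma>"
    proof (rule inj_image_mem_iff[symmetric])
      show "inj (\<lambda>y. T (y - x))"
        by (rule injI) (simp add: inj_eq[OF bij_is_inj[OF bij]])
    qed
    also have "\<dots> \<longleftrightarrow> T (y - x) $ 2 = g (T (y - x) $ 1)"
      using that N_iff[of "T (y - x)"] by (simp add: U_def D_def)
    finally show ?thesis by (simp add: \<phi>_def)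
  qed
  have flat: "\<phi> ` (\<Gamma> \<inter> U) = ?L \<inter> V"
  proof (intro equalityI subsetI)
    fix z assume "z \<in> ?L \<inter> V"
    then show "z \<in> \<phi> ` (\<Gamma> \<inter> U)"
      using \<Gamma>_iff[of "\<psi> z"] by (intro image_eqI[of _ _ "\<psi> z"]) (auto simp: \<phi>\<psi> V_def)
  qed (use \<Gamma>_iff \<phi>U in auto)
  have xU: "x \<in> U" using N(2) \<epsilon>(1) by (simp add: U_def D_def linear_0[OF linT])
  \<comment> \<open>The germs agree at the base point itself, as 0 \<in> N; hence x \<in> \<Gamma>
    once the origin lies on the graph.\<close>
  have "eval_fps F 0 = 0"
    using F_eval[of 0] \<epsilon>(1) \<sigma>[of 0] \<open>p < q\<close> by (simp add: eval_fps_at_0)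
  then have "x \<in> \<Gamma>"
    using \<Gamma>_iff[OF xU] by (simp add: \<phi>_def g_def linear_0[OF linT])
  moreover have "embedded_Ck_submanifold k 1 (\<Gamma> \<inter> U)"
    unfolding embedded_Ck_submanifold_def
  \<comment> \<open>\<open>U\<close> serves as the neighbourhood of \<open>x\<close>, and the same
    chart works at every point of \<Gamma> \<inter> U.\<close>
  proof
    fix y assume "y \<in> \<Gamma> \<inter> U"
    moreover have "\<Gamma> \<inter> U \<inter> U = \<Gamma> \<inter> U" by blast
    ultimately have "open U \<and> y \<in> U \<and> open V \<and> homeomorphism U V \<phi> \<psi> \<and> Ck_on k \<phi> U \<and> Ck_on k \<psi> V \<and>
        subspace ?L \<and> dim ?L = 1 \<and> \<phi> ` (\<Gamma> \<inter> U \<inter> U) = ?L \<inter> V"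
      using openU openV homeo Ck_on_subset[OF Ck\<phi> UD'] Ck_on_subset[OF Ck\<psi> VD] subL dimL flat
      by simp
    then show "\<exists>U' (V :: (real^2) set) \<phi> \<psi> L. open U' \<and> y \<in> U' \<and> open V \<and> homeomorphism U' V \<phi> \<psi> \<and>
        Ck_on k \<phi> U' \<and> Ck_on k \<psi> V \<and> subspace L \<and> dim L = 1 \<and> \<phi> ` (\<Gamma> \<inter> U \<inter> U') = L \<inter> V"
      by (intro exI)
  qed
  ultimately show ?thesis
    unfolding locally_embedded_Ck_submanifold_def using openU xU by blast
qed

end
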